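(* Let $b,c,d$ be positive integers. (1) Every set in $\mathrm{GC}(b,c,d)$ is finite if and only if $d>b$ or $d>c$. (2) If $d\leq b$ and $d\leq c$, then $\mathrm{GC}(b,c,d)$ is nontrivial.
   Context: Sets are languages over $\Sigma=\{0,1\}$; FP is the class of polynomial-time computable functions. For positive integers $b,c,d$, $\mathrm{GC}(b,c,d)$ is the class of sets $L$ for which there is an FP function $f$ such that for every $n\geq1$ and all distinct strings $y_1,\dots,y_n$ (given as a tuple in lexicographic order): $f(y_1,\dots,y_n)\subseteq\{y_1,\dots,y_n\}$, $\|f(y_1,\dots,y_n)\|\leq c$, and if $\|L\cap\{y_1,\dots,y_n\}\|\geq b$ then $\|L\cap f(y_1,\dots,y_n)\|\geq d$. A class of sets is nontrivial if it contains some infinite set but does not contain all subsets of $\Sigma^*$. *)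

theory Defs
  imports Complex_Main "HOL-Library.List_Lexorder" "HOL-Computational_Algebra.Polynomial"
begin

type_synonym bstring = "bool list"

text \<open>
  Deterministic single-tape Turing machines with a two-way infinite tape. States and tape symbols
  are natural numbers; symbol 0 is the blank, 1 and 2 are the input symbols 0 and 1. A machine is
  a partial transition function with finite domain (so only finitely many states and symbols
  matter), started in state 0; it halts when no transition applies.
\<close>

datatype move = Left | Stay | Right

type_synonym tm = "nat \<times> nat \<rightharpoonup> nat \<times> nat \<times> move"
type_synonym tape = "int \<Rightarrow> nat"
type_synonym config = "nat \<times> tape \<times> int"

fun shift :: "move \<Rightarrow> int" where
  "shift Left = -1"
| "shift Stay = 0"
| "shift Right = 1"

fun tm_step :: "tm \<Rightarrow> config \<Rightarrow> config" where
  "tm_step M (q, t, h) =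
     (case M (q, t h) of
        None \<Rightarrow> (q, t, h)
      | Some (q', s, m) \<Rightarrow> (q', t(h := s), h + shift m))"

fun halted :: "tm \<Rightarrow> config \<Rightarrow> bool" where
  "halted M (q, t, h) \<longleftrightarrow> M (q, t h) = None"

fun tape_content :: "config \<Rightarrow> tape" where
  "tape_content (q, t, h) = t"

definition tape_of :: "bstring \<Rightarrow> tape" where
  "tape_of x i = (if 0 \<le> i \<and> i < int (length x) then (if x ! nat i then 2 else 1) else 0)"

definition init_config :: "bstring \<Rightarrow> config" where
  "init_config x = (0, tape_of x, 0)"

definition computes_in_time :: "tm \<Rightarrow> (bstring \<Rightarrow> bstring) \<Rightarrow> (nat \<Rightarrow> nat) \<Rightarrow> bool" where
  "computes_in_time M g T \<longleftrightarrow>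
     (\<forall>x. \<exists>k \<le> T (length x).
        halted M ((tm_step M ^^ k) (init_config x)) \<and>
        tape_content ((tm_step M ^^ k) (init_config x)) = tape_of (g x))"

definition FP :: "(bstring \<Rightarrow> bstring) set" where
  "FP = {g. \<exists>(M :: tm) (p :: nat poly). finite (dom M) \<and> computes_in_time M g (poly p)}"

text \<open>
  Tuples of strings are encoded as strings by doubling every bit and terminating each component
  by 01. A finite set is encoded as the tuple of its elements in lexicographic order; the
  order on strings is the dictionary order with 0 before 1.
\<close>

definition encode_tuple :: "bstring list \<Rightarrow> bstring" where
  "encode_tuple ys = concat (map (\<lambda>y. concat (map (\<lambda>a. [a, a]) y) @ [False, True]) ys)"

definition encode_set :: "bstring set \<Rightarrow> bstring" where
  "encode_set A = encode_tuple (sorted_list_of_set A)"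

definition input_tuples :: "bstring list set" where
  "input_tuples = {ys. ys \<noteq> [] \<and> distinct ys \<and> sorted ys}"

text \<open>
  Only the values on \<^term>\<open>input_tuples\<close> matter, so \<open>f\<close> is polynomial-time computable if some
  function in \<^term>\<open>FP\<close> maps the encoding of every such tuple \<open>ys\<close> to the encoding of \<open>f ys\<close>.
\<close>

definition poly_time_selector :: "(bstring list \<Rightarrow> bstring set) \<Rightarrow> bool" where
  "poly_time_selector f \<longleftrightarrow>
     (\<exists>g \<in> FP. \<forall>ys \<in> input_tuples. finite (f ys) \<and> g (encode_tuple ys) = encode_set (f ys))"

definition GC :: "nat \<Rightarrow> nat \<Rightarrow> nat \<Rightarrow> bstring set set" where
  "GC b c d = {L. \<exists>f. poly_time_selector f \<and>
     (\<forall>ys \<in> input_tuples.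
        f ys \<subseteq> set ys \<and> card (f ys) \<le> c \<and>
        (card (L \<inter> set ys) \<ge> b \<longrightarrow> card (L \<inter> f ys) \<ge> d))}"

definition nontrivial :: "bstring set set \<Rightarrow> bool" where
  "nontrivial C \<longleftrightarrow> (\<exists>L \<in> C. infinite L) \<and> \<not> (\<forall>L. L \<in> C)"

end

theory Submission
  imports Defs "HOL-Library.Countable_Set"
begin

text \<open>
  If \<open>d > b\<close> or \<open>d > c\<close>, a selector must fail on any \<open>b\<close> elements of \<open>L\<close>, so \<open>L\<close> has fewer than
  \<open>b\<close> elements. If \<open>d \<le> b\<close> and \<open>d \<le> c\<close>, returning the first \<open>d\<close> input strings shows that
  the set of all strings is in \<open>GC b c d\<close>; a single left-to-right pass that erases
  everything behind the \<open>d\<close>-th terminator computes this selector. Finally, there are only countably many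
  selectors, and one set \<open>L\<close> defeats them all: reserve disjoint blocks of \<open>b + c\<close> strings,
  one for each selector, and remove from each block the at most \<open>c\<close> strings selected there. At least \<open>b\<close>
  strings of \<open>L\<close> remain in the block, but none of them is selected.
\<close>

section \<open>Computing the selection of the first components\<close>

text \<open>
  State \<open>3 * j + r\<close> means that \<open>j\<close> terminators have been read; \<open>r\<close> is \<open>0\<close> between two pairs of bits,
  and \<open>1\<close> or \<open>2\<close> after the first bit 0 or 1 of a pair. State \<open>3 * d\<close> erases.
\<close>

definition scan_state :: "nat \<Rightarrow> bool \<Rightarrow> nat" where
  "scan_state q a =
     (if q mod 3 = 0 then q + (if a then 2 else 1)
      else if q mod 3 = 1 then (if a then q + 2 else q - 1)
      else q - 2)"

text \<open>The list ends where \<open>scan_tm\<close> starts erasing, because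
  \<open>tape_of\<close> is blank beyond the end of its string.\<close>

fun scan :: "nat \<Rightarrow> nat \<Rightarrow> bstring \<Rightarrow> bstring" where
  "scan d q [] = []"
| "scan d q (a # x) = (if q = 3 * d then [] else a # scan d (scan_state q a) x)"

definition scan_tm :: "nat \<Rightarrow> tm" where
  "scan_tm d = (\<lambda>(q, s).
     if q \<le> 3 * d \<and> (s = 1 \<or> s = 2) then
       Some (if q = 3 * d then (q, 0, Right) else (scan_state q (s = 2), s, Right))
     else None)"

lemma scan_state_le: "q < 3 * d \<Longrightarrow> scan_state q a \<le> 3 * d"
  unfolding scan_state_def by (auto; presburger)

lemma finite_dom_scan_tm: "finite (dom (scan_tm d))"
proof (rule finite_subset)
  show "dom (scan_tm d) \<subseteq> {..3 * d} \<times> {1, 2}"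
    by (auto simp: scan_tm_def dom_def split: if_splits)
qed auto

lemma length_scan_le: "length (scan d q x) \<le> length x"
  by (induction x arbitrary: q) auto

lemma scan_final_state: "scan d (3 * d) x = []"
  by (cases x) auto

lemma tape_of_Cons: "tape_of (a # x) i = (if i = 0 then if a then 2 else 1 else tape_of x (i - 1))"
proof (cases "i \<le> 0")
  case False
  then have "nat i = Suc (nat (i - 1))" by simp
  with False show ?thesis by (auto simp: tape_of_def)
qed (auto simp: tape_of_def)

text \<open>The head only moves right, so cells left of \<open>h\<close> may hold anything; keeping
  them, \<open>q\<close> and \<open>h\<close> general lets the induction on \<open>x\<close> go
  through.\<close>

lemma scan_tm_run:
  assumes "q \<le> 3 * d" and "\<And>i. i \<ge> h \<Longrightarrow> t i = tape_of x (i - h)"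
  shows "\<exists>q'. (tm_step (scan_tm d) ^^ length x) (q, t, h) =
    (q', (\<lambda>i. if i < h then t i else tape_of (scan d q x) (i - h)), h + int (length x))"
  using assms
proof (induction x arbitrary: q t h)
  case Nil
  then show ?case by (auto simp: fun_eq_iff)
next
  case (Cons a x)
  define s :: nat where "s = (if a then 2 else 1)"
  have th: "t h = s" using Cons.prems(2)[of h] by (simp add: tape_of_Cons s_def)
  have s: "s = 1 \<or> s = 2" "(s = 2) = a" by (auto simp: s_def)
  define q1 where "q1 = (if q = 3 * d then q else scan_state q a)"
  define s1 where "s1 = (if q = 3 * d then 0 else s)"
  have step: "tm_step (scan_tm d) (q, t, h) = (q1, t(h := s1), h + 1)"
    using th s Cons.prems(1) by (auto simp: scan_tm_def q1_def s1_def)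
  have q1: "q1 \<le> 3 * d"
    using Cons.prems(1) scan_state_le[of q d a] by (auto simp: q1_def)
  have t1: "(t(h := s1)) i = tape_of x (i - (h + 1))" if "i \<ge> h + 1" for i
    using Cons.prems(2)[of i] that by (simp add: tape_of_Cons algebra_simps)
  obtain q' where q': "(tm_step (scan_tm d) ^^ length x) (q1, t(h := s1), h + 1) =
    (q', (\<lambda>i. if i < h + 1 then (t(h := s1)) i else tape_of (scan d q1 x) (i - (h + 1))),
     h + 1 + int (length x))"
    using Cons.IH[OF q1 t1] by blast
  have "(if i < h + 1 then (t(h := s1)) i else tape_of (scan d q1 x) (i - (h + 1))) =
    (if i < h then t i else tape_of (scan d q (a # x)) (i - h))" for i
  proof (cases "q = 3 * d")
    case True
    then show ?thesis by (auto simp: s1_def q1_def scan_final_state tape_of_def)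
  next
    case False
    then show ?thesis
      by (auto simp: s1_def q1_def s_def tape_of_Cons algebra_simps)
  qed
  then have "(tm_step (scan_tm d) ^^ length (a # x)) (q, t, h) =
    (q', (\<lambda>i. if i < h then t i else tape_of (scan d q (a # x)) (i - h)),
     h + int (length (a # x)))"
    using q' by (simp add: funpow_swap1 step del: tm_step.simps scan.simps)
  then show ?case by blast
qed

lemma scan_in_FP: "scan d 0 \<in> FP"
proof -
  have "\<exists>k \<le> poly [:0, 1:] (length x).
        halted (scan_tm d) ((tm_step (scan_tm d) ^^ k) (init_config x)) \<and>
        tape_content ((tm_step (scan_tm d) ^^ k) (init_config x)) = tape_of (scan d 0 x)" for x
  proof -
    obtain q' where run: "(tm_step (scan_tm d) ^^ length x) (0, tape_of x, 0) =
      (q', (\<lambda>i. if i < 0 then tape_of x i else tape_of (scan d 0 x) (i - 0)), 0 + int (length x))"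
      using scan_tm_run[of 0 d 0 "tape_of x" x] by auto
    have "(\<lambda>i. if i < 0 then tape_of x i else tape_of (scan d 0 x) (i - 0)) = tape_of (scan d 0 x)"
      by (auto simp: fun_eq_iff tape_of_def)
    \<comment> \<open>The head ends on cell \<open>length x\<close>; a blank there means that no
      transition applies.\<close>
    moreover have "tape_of (scan d 0 x) (int (length x)) = 0"
      using length_scan_le[of d 0 x] by (simp add: tape_of_def)
    ultimately show ?thesis using run
      by (intro exI[of _ "length x"]) (auto simp: init_config_def scan_tm_def)
  qed
  then show ?thesis
    unfolding FP_def computes_in_time_def using finite_dom_scan_tm by blast
qed

section \<open>Effect of the scan on encoded tuples\<close>

lemma encode_tuple_Nil: "encode_tuple [] = []"
  by (simp add: encode_tuple_def)

lemma encode_tuple_Cons: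
  "encode_tuple (y # ys) = concat (map (\<lambda>a. [a, a]) y) @ False # True # encode_tuple ys"
  by (simp add: encode_tuple_def)

text \<open>The states \<open>3 * j\<close> to \<open>3 * j + 2\<close> lie below
  \<open>3 * d\<close>, so nothing is erased. Pairs of equal bits lead back to \<open>3 * j\<close>;
  only the terminator advances \<open>j\<close>.\<close>

lemma scan_component:
  assumes "j < d"
  shows "scan d (3 * j) (concat (map (\<lambda>a. [a, a]) y) @ False # True # z) =
    concat (map (\<lambda>a. [a, a]) y) @ False # True # scan d (3 * Suc j) z"
proof -
  have ne: "3 * j \<noteq> 3 * d" "Suc (3 * j) \<noteq> 3 * d" "Suc (Suc (3 * j)) \<noteq> 3 * d"
    using assms by presburger+
  have md: "Suc (3 * j) mod 3 = 1" "Suc (Suc (3 * j)) mod 3 = 2"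
    by presburger+
  have suc: "Suc (Suc (Suc (3 * j))) = 3 + 3 * j"
    by simp
  show ?thesis
    using ne assms by (induction y) (simp_all add: scan_state_def md suc)
qed

lemma scan_encode_tuple:
  "j \<le> d \<Longrightarrow> scan d (3 * j) (encode_tuple ys) = encode_tuple (take (d - j) ys)"
proof (induction ys arbitrary: j)
  case Nil
  then show ?case by (simp add: encode_tuple_Nil)
next
  case (Cons y ys)
  show ?case
  proof (cases "j = d")
    case True
    then show ?thesis by (simp add: scan_final_state encode_tuple_Nil)
  next
    case False
    with Cons.prems have j: "j < d" by simp
    then have "d - j = Suc (d - Suc j)" by simp
    with Cons.IH[of "Suc j"] j show ?thesis
      by (simp only: encode_tuple_Cons scan_component take_Suc_Cons Suc_le_eq)
  qed
qed

text \<open>A prefix of a sorted distinct list is the sorted list of its own elements.\<close>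

lemma poly_time_selector_take: "poly_time_selector (\<lambda>ys. set (take d ys))"
proof -
  have "scan d 0 (encode_tuple ys) = encode_set (set (take d ys))" if "ys \<in> input_tuples" for ys
    using that scan_encode_tuple[of 0 d ys]
    by (simp add: encode_set_def input_tuples_def sorted_list_of_set.idem_if_sorted_distinct)
  then show ?thesis
    unfolding poly_time_selector_def using scan_in_FP by blast
qed

text \<open>For \<open>UNIV\<close> the premise says that the tuple has at least \<open>b\<close>
  entries, hence at least \<open>d\<close>.\<close>

lemma UNIV_in_GC:
  assumes "d \<le> b" and "d \<le> c"
  shows "UNIV \<in> GC b c d"
  unfolding GC_def
  using assms poly_time_selector_take[of d]
  by (auto intro!: exI[of _ "\<lambda>ys. set (take d ys)"] dest: in_set_takeD
      simp: input_tuples_def distinct_card)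

section \<open>The case of finite sets only\<close>

lemma sorted_list_of_set_in_input_tuples:
  "finite A \<Longrightarrow> A \<noteq> {} \<Longrightarrow> sorted_list_of_set A \<in> input_tuples"
  by (auto simp: input_tuples_def)

lemma finite_if_in_GC:
  assumes "L \<in> GC b c d" and "b > 0" and "d > b \<or> d > c"
  shows "finite L"
proof (rule ccontr)
  assume "infinite L"
  then obtain A where A: "finite A" "card A = b" "A \<subseteq> L"
    using infinite_arbitrarily_large by blast
  with \<open>b > 0\<close> have "sorted_list_of_set A \<in> input_tuples"
    by (intro sorted_list_of_set_in_input_tuples) auto
  with A assms(1) obtain B where B: "B \<subseteq> A" "card B \<le> c" "card (L \<inter> A) \<ge> b \<longrightarrow> card (L \<inter> B) \<ge> d"
    unfolding GC_def by fastforce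
  \<comment> \<open>All of \<open>A\<close> lies in \<open>L\<close>, so \<open>B\<close> needs
    \<open>d\<close> elements, yet has at most \<open>b\<close> and at most
    \<open>c\<close>.\<close>
  moreover have "L \<inter> A = A" "L \<inter> B = B" using A B by auto
  moreover have "card B \<le> b" using A B card_mono by metis
  ultimately show False using A assms(3) by auto
qed

section \<open>Diagonalization\<close>

instance move :: countable
  by countable_datatype

lemma tape_of_inject: "tape_of x = tape_of y \<Longrightarrow> x = y"
proof (induction x arbitrary: y)
  case Nil
  from fun_cong[OF this, of 0] show ?case
    by (cases y) (auto simp: tape_of_Cons tape_of_def[of "[]"] split: if_splits)
next
  case (Cons a x)
  show ?case
  proof (cases y)
    case Nil
    with fun_cong[OF Cons.prems, of 0] show ?thesis
      by (auto simp: tape_of_Cons tape_of_def[of "[]"] split: if_splits)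
  next
    case (Cons a' y')
    have eq: "tape_of (a # x) i = tape_of (a' # y') i" for i
      using Cons.prems local.Cons by simp
    have "a = a'" using eq[of 0] by (auto simp: tape_of_Cons split: if_splits)
    moreover have "tape_of x i = tape_of y' i" for i
    proof (cases "i < 0")
      case True
      then show ?thesis by (simp add: tape_of_def)
    next
      case False
      then show ?thesis using eq[of "i + 1"] by (simp add: tape_of_Cons)
    qed
    ultimately show ?thesis using Cons.IH[of y'] local.Cons by auto
  qed
qed

lemma halted_funpow:
  assumes "halted M cf"
  shows "(tm_step M ^^ k) cf = cf"
proof -
  have "tm_step M cf = cf" using assms by (cases cf) auto
  then show ?thesis by (induction k) auto
qed

text \<open>Both configurations equal the one after \<open>k + l\<close> steps.\<close>

lemma halting_config_unique:
  assumes "halted M ((tm_step M ^^ k) cf)" and "halted M ((tm_step M ^^ l) cf)"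
  shows "(tm_step M ^^ k) cf = (tm_step M ^^ l) cf"
proof -
  have "(tm_step M ^^ (m + n)) cf = (tm_step M ^^ n) cf"
    if "halted M ((tm_step M ^^ n) cf)" for m n
    using halted_funpow[OF that] by (simp add: funpow_add)
  from this[OF assms(1), of l] this[OF assms(2), of k] show ?thesis
    by (simp add: add.commute)
qed

text \<open>The machine alone fixes the function, whatever the time bounds, so to count
  \<open>FP\<close> it suffices to count machines.\<close>

lemma computes_in_time_unique:
  assumes "computes_in_time M g T" and "computes_in_time M g' T'"
  shows "g = g'"
proof
  fix x
  from assms show "g x = g' x"
    unfolding computes_in_time_def by (metis halting_config_unique tape_of_inject)
qed

text \<open>A partial function is determined by its graph, here a finite subset of a countable
  type.\<close>

lemma countable_finite_dom:
  "countable {M :: 'a::countable \<rightharpoonup> 'b::countable. finite (dom M)}"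
proof (rule countable_image_inj_on)
  show "inj_on Map.graph {M :: 'a \<rightharpoonup> 'b. finite (dom M)}"
    by (rule inj_onI) (auto simp: Map.graph_def set_eq_iff fun_eq_iff, metis option.exhaust)
  have "Map.graph ` {M :: 'a \<rightharpoonup> 'b. finite (dom M)} \<subseteq> Collect finite"
    by auto
  then show "countable (Map.graph ` {M :: 'a \<rightharpoonup> 'b. finite (dom M)})"
    by (rule countable_subset) (rule countable_Collect_finite)
qed

lemma countable_FP: "countable FP"
proof -
  have "\<forall>g \<in> FP. \<exists>M. finite (dom M) \<and> (\<exists>T. computes_in_time M g T)"
    unfolding FP_def by blast
  then obtain machine where machine:
    "\<And>g. g \<in> FP \<Longrightarrow> finite (dom (machine g)) \<and> (\<exists>T. computes_in_time (machine g) g T)"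
    by metis
  show ?thesis
  proof (rule countable_image_inj_on)
    show "inj_on machine FP"
      by (rule inj_onI) (metis machine computes_in_time_unique)
    show "countable (machine ` FP)"
      by (rule countable_subset[OF _ countable_finite_dom]) (use machine in auto)
  qed
qed

section \<open>Unique decoding of tuples and sets\<close>

lemma encode_component_inject:
  "concat (map (\<lambda>a. [a, a]) y) @ False # True # z = concat (map (\<lambda>a. [a, a]) y') @ False # True # z'
    \<Longrightarrow> y = y' \<and> z = z'"
proof (induction y arbitrary: y')
  case Nil
  then show ?case by (cases y') auto
next
  case (Cons a y)
  then show ?case by (cases y') auto
qed

lemma encode_tuple_inject: "encode_tuple ys = encode_tuple zs \<Longrightarrow> ys = zs"
proof (induction ys arbitrary: zs)
  case Nil
  then show ?case by (cases zs) (auto simp: encode_tuple_Nil encode_tuple_Cons)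
next
  case (Cons y ys)
  then show ?case
    by (cases zs)
      (auto simp: encode_tuple_Nil encode_tuple_Cons dest: encode_component_inject)
qed

lemma inj_on_encode_set: "inj_on encode_set {A. finite A}"
  by (rule inj_onI)
    (metis encode_set_def encode_tuple_inject mem_Collect_eq sorted_list_of_set_inject)

lemma ex_not_in_GC:
  assumes "b > 0" and "d > 0"
  shows "\<exists>L. L \<notin> GC b c d"
proof -
  define N where "N = b + c"
  \<comment> \<open>Strings of ones: dividing the length by \<open>N\<close> recovers the block
    index.\<close>
  define Y where "Y i = (\<lambda>m. replicate m True) ` {i * N..<i * N + N}" for i
  have inj: "inj_on (\<lambda>m. replicate m True) A" for A
    by (rule inj_onI) (metis length_replicate)
  have fin: "finite (Y i)" and cardY: "card (Y i) = N" for i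
    by (simp_all add: Y_def card_image[OF inj])
  have disj: "i = j" if "y \<in> Y i" "y \<in> Y j" for i j y
  proof -
    have "length y div N = i" if "y \<in> Y i" for i
      using that by (auto simp: Y_def intro!: div_nat_eqI simp: algebra_simps)
    with that show ?thesis by metis
  qed
  \<comment> \<open>The decoded value of the \<open>i\<close>-th function of \<open>FP\<close> on
    \<open>Y i\<close>. It is unspecified if that value encodes no finite set; such an
    \<open>i\<close> never arises from a selector.\<close>
  define S where "S i = the_inv_into {A. finite A} encode_set
    (from_nat_into FP i (encode_tuple (sorted_list_of_set (Y i))))" for i
  define L where "L = (\<Union>i. Y i - S i)"
  \<comment> \<open>Whatever \<open>S\<close> is, the other blocks contribute nothing to
    \<open>Y i\<close>.\<close>
  have LY: "L \<inter> Y i = Y i - S i" for i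
    using disj by (auto simp: L_def)
  have "L \<notin> GC b c d"
  proof
    assume "L \<in> GC b c d"
    then obtain f where f: "poly_time_selector f"
      and sel: "\<And>ys. ys \<in> input_tuples \<Longrightarrow> f ys \<subseteq> set ys \<and> card (f ys) \<le> c \<and>
        (card (L \<inter> set ys) \<ge> b \<longrightarrow> card (L \<inter> f ys) \<ge> d)"
      unfolding GC_def by blast
    from f obtain g where "g \<in> FP"
      and g: "\<And>ys. ys \<in> input_tuples \<Longrightarrow> finite (f ys) \<and> g (encode_tuple ys) = encode_set (f ys)"
      unfolding poly_time_selector_def by blast
    from countable_FP \<open>g \<in> FP\<close> obtain i where i: "from_nat_into FP i = g"
      using from_nat_into_surj by metis
    define ys where "ys = sorted_list_of_set (Y i)"
    have "Y i \<noteq> {}" using cardY[of i] \<open>b > 0\<close> by (auto simp: N_def)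
    then have ys: "ys \<in> input_tuples"
      unfolding ys_def by (intro sorted_list_of_set_in_input_tuples fin)
    have set_ys: "set ys = Y i" by (simp add: ys_def fin)
    have S: "S i = f ys"
      using g[OF ys] the_inv_into_f_f[OF inj_on_encode_set, of "f ys"]
      by (simp add: S_def i flip: ys_def)
    have "card (Y i - S i) \<ge> card (Y i) - card (S i)"
      using g[OF ys] by (intro diff_card_le_card_Diff) (simp add: S)
    then have "card (L \<inter> set ys) \<ge> b"
      using conjunct1[OF conjunct2[OF sel[OF ys]]] by (simp add: set_ys LY cardY N_def S)
    then have "card (L \<inter> f ys) \<ge> d" using sel[OF ys] by blast
    moreover have "L \<inter> f ys = {}"
      using LY[of i] sel[OF ys] by (auto simp: set_ys S)
    ultimately show False using \<open>d > 0\<close> by simp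
  qed
  then show ?thesis by blast
qed

theorem theorem4p11:
  fixes b c d :: nat
  assumes "b > 0" and "c > 0" and "d > 0"
  shows "((\<forall>L \<in> GC b c d. finite L) \<longleftrightarrow> d > b \<or> d > c) \<and>
         (d \<le> b \<and> d \<le> c \<longrightarrow> nontrivial (GC b c d))"
proof -
  have inf: "infinite (UNIV :: bstring set)"
    by (rule infinite_UNIV_listI)
  have "d > b \<or> d > c" if "\<forall>L \<in> GC b c d. finite L"
    using that inf UNIV_in_GC[of d b c] by (meson not_less)
  moreover have "nontrivial (GC b c d)" if "d \<le> b" "d \<le> c"
    unfolding nontrivial_def
    using UNIV_in_GC[OF that] inf ex_not_in_GC[OF assms(1,3)] by blast
  ultimately show ?thesis
    using finite_if_in_GC assms(1) by blast
qed

end
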